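(* Let $\Delta>0$ and $0<\delta<1$. Let $\mathcal{P}$ be a probability measure on a Hilbert space $\mathcal{H}$ with $\mathbb{E}_{\mathcal{P}}\|x\|^2=r^2<\infty$. Suppose inputs are drawn independently according to $\mathcal{P}$. If we succeed in correctly classifying $\ell$ such inputs by a maximum margin hyperplane with margin $\Delta$, then with confidence $1-\delta$ the generalization error will be bounded from above by $$\epsilon := \frac{\tilde O\!\left(\frac{r\,\ell^{1/2}}{\Delta}\right)+\log\frac1\delta}{\ell},$$ where $\tilde O$ hides multiplicative polylogarithmic factors involving $\ell$, $r$ and $\Delta$.
   Context: Setting: binary classification. Each input $x\in\mathcal{H}$ carries a label $y\in\{-1,+1\}$, each $x$ occurring with only one label. A linear hyperplane classifier is an oriented (affine) hyperplane in $\mathcal{H}$, labeling points $\pm1$ according to the side on which they lie; its generalization error (risk) is the probability that it mislabels a fresh random input. The maximum margin hyperplane for a sample is one that classifies all samples correctly and maximizes the minimal distance (the margin) from the sample points to the hyperplane. "With confidence $1-\delta$" means: with probability at least $1-\delta$ over the sample of size $\ell$, if the sample is correctly classified by the maximum margin hyperplane with margin $\Delta$, then its generalization error is at most $\epsilon$. $\tilde O$ notation: the assertion is that there is a universal constant $c>0$ such that the statement holds with $\tilde O(X)$ replaced by $X\cdot c\,(1+|\log \ell|+|\log r|+|\log\Delta|)^{c}$.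
   Formalization: The probability measure is additionally assumed to give full measure to the closure of a countable set (automatic when the Hilbert space is separable); otherwise, given a measurable cardinal, there are measures for which the event is not measurable and the claim fails. *)

theory Defs
  imports "HOL-Probability.Probability"
begin

text \<open>
  An oriented affine hyperplane is given by a normal vector \<open>w \<noteq> 0\<close> and an offset \<open>b\<close>;
  its positive side is where \<open>w \<bullet> z + b > 0\<close>.
\<close>

definition hyperplane :: "'a::real_inner \<Rightarrow> real \<Rightarrow> 'a set" where
  "hyperplane w b = {z. w \<bullet> z + b = 0}"

text \<open>
  The value is \<open>0\<close> on the hyperplane itself, so a point lying on it
  counts as mislabelled, whatever its true label in \<open>{-1, 1}\<close>.
\<close>

definition side :: "'a::real_inner \<Rightarrow> real \<Rightarrow> 'a \<Rightarrow> real" where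
  "side w b x = sgn (w \<bullet> x + b)"

definition risk :: "'a::real_inner measure \<Rightarrow> ('a \<Rightarrow> real) \<Rightarrow> 'a \<Rightarrow> real \<Rightarrow> real" where
  "risk P y w b = measure P {x \<in> space P. side w b x \<noteq> y x}"

text \<open>A sample of size \<open>l\<close> is a function on the index set \<open>{..<l}\<close>.\<close>

definition classifies ::
    "('a::real_inner \<Rightarrow> real) \<Rightarrow> nat \<Rightarrow> (nat \<Rightarrow> 'a) \<Rightarrow> 'a \<Rightarrow> real \<Rightarrow> bool" where
  "classifies y l x w b \<longleftrightarrow> (\<forall>i<l. side w b (x i) = y (x i))"

definition margin :: "nat \<Rightarrow> (nat \<Rightarrow> 'a::real_inner) \<Rightarrow> 'a \<Rightarrow> real \<Rightarrow> real" where
  "margin l x w b = Min ((\<lambda>i. infdist (x i) (hyperplane w b)) ` {..<l})"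

text \<open>
  If all labels in the sample agree, the margin is unbounded over the affine hyperplanes
  that classify it correctly, and there is no maximum margin hyperplane.
\<close>

definition max_margin_hyperplane ::
    "('a::real_inner \<Rightarrow> real) \<Rightarrow> nat \<Rightarrow> (nat \<Rightarrow> 'a) \<Rightarrow> 'a \<Rightarrow> real \<Rightarrow> bool" where
  "max_margin_hyperplane y l x w b \<longleftrightarrow>
     w \<noteq> 0 \<and> classifies y l x w b \<and>
     (\<forall>w' b'. w' \<noteq> 0 \<longrightarrow> classifies y l x w' b' \<longrightarrow> margin l x w' b' \<le> margin l x w b)"

text \<open>
  Holds for every Borel probability measure on a separable space. On a nonseparable Hilbert
  space it fails only for measures whose existence requires a large cardinal. Some of these
  concentrate on an orthonormal set in such a way that the product measure does not decide
  whether two independent draws coincide, and generalization from a sample breaks down.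
\<close>

definition separably_supported :: "'a::topological_space measure \<Rightarrow> bool" where
  "separably_supported P \<longleftrightarrow> (\<exists>S. countable S \<and> (AE x in P. x \<in> closure S))"

text \<open>
  The bound \<open>\<epsilon>\<close>, with the soft-O term replaced by its argument times the polylogarithmic
  factor with constant \<open>c\<close>. For \<open>r = 0\<close> that term is \<open>0\<close>.
\<close>

definition error_bound :: "real \<Rightarrow> nat \<Rightarrow> real \<Rightarrow> real \<Rightarrow> real \<Rightarrow> real" where
  "error_bound c l r \<Delta> \<delta> =
     ((r * sqrt (real l) / \<Delta>) *
        (c * (1 + \<bar>ln (real l)\<bar> + \<bar>ln r\<bar> + \<bar>ln \<Delta>\<bar>) powr c) + ln (1 / \<delta>)) / real l"

text \<open>
  Probability at least \<open>p\<close> for a property of the points of \<open>M\<close> that is not known in advance to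
  define a measurable set; for a measurable property of a probability space this is just
  \<open>p \<le> measure M {x \<in> space M. Q x}\<close>.
\<close>

definition with_prob_ge :: "'b measure \<Rightarrow> real \<Rightarrow> ('b \<Rightarrow> bool) \<Rightarrow> bool" where
  "with_prob_ge M p Q \<longleftrightarrow> (\<exists>A\<in>sets M. p \<le> measure M A \<and> (\<forall>x\<in>A. Q x))"

text \<open>
  Upper limit for the universal constant. The space is a type, so an unrestricted existential
  over \<open>c\<close> would allow \<open>c\<close> to depend on the space. The bound increases with \<open>c\<close>, so a
  numerical limit makes a single constant work for all spaces; its value is immaterial.
\<close>

definition const_limit :: real where
  "const_limit = 10 ^ 9"

end

theory Submission imports Defs begin

text \<open>
  Let \<open>D = r * sqrt l / \<Delta>\<close> and \<open>R\<^sup>2 = D * \<Delta>\<^sup>2\<close>. By Chebyshev, the ball of radius \<open>R\<close> misses mass at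
  most \<open>r\<^sup>2 / R\<^sup>2 = D / l\<close>, so only errors inside the ball matter. There a vector \<open>w\<close> is
  approximated as by the perceptron: start at \<open>0\<close> and, while the approximation \<open>v\<close> is off by
  more than \<open>g\<close> at some datum \<open>u\<close>, add a multiple of \<open>\<plusminus>u\<close>. Every step lowers
  \<open>(norm (w - v))\<^sup>2\<close> by \<open>(g / R)\<^sup>2\<close>, and with \<open>g\<close> of order \<open>\<Delta>\<close> there are \<open>K = O(D)\<close> steps.
  The datum is a sample point as long as \<open>v\<close> is off on the sample, and otherwise a fresh random
  draw, which serves as long as \<open>v\<close> is off on a set of mass greater than \<open>\<eta>\<close>. So for a
  sample that fits a hyperplane of large risk, random walks of this kind reach with total
  weight at least \<open>\<eta> ^ K\<close> a vector that still fits the sample and still has large risk.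
  On the other hand such a walk looks at no more than \<open>K\<close> sample points, and the others are
  independent of it, so the expected total weight is at most
  \<open>(3 * (l + 1)) ^ K * (1 - (e - \<eta>)) ^ (l - K)\<close>. Markov's inequality concludes. As there is no
  symmetrization, \<open>ln (1 / \<delta>)\<close> enters with coefficient \<open>1\<close>.

  For small \<open>D\<close> the additive constants of this argument are not absorbed by the bound, and a
  direct union bound is used instead.
\<close>

section \<open>Weighted random walks\<close>

text \<open>
  Total weight with which \<open>k\<close> further steps lead from \<open>v\<close> to a vector counted by \<open>G\<close>. The
  index \<open>i\<close> is a step along a sample point, the integral a step along a fresh draw, and the
  sign \<open>s = 0\<close> allows the walk to rest.
\<close>

primrec walk :: "'d measure \<Rightarrow> ('d \<Rightarrow> 'b::real_inner) \<Rightarrow> real \<Rightarrow> nat \<Rightarrow> (nat \<Rightarrow> 'd)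
    \<Rightarrow> nat \<Rightarrow> ('b \<Rightarrow> ennreal) \<Rightarrow> 'b \<Rightarrow> ennreal" where
  "walk N u a l S 0 G v = G v"
| "walk N u a l S (Suc k) G v =
     (\<Sum>s\<in>{-1, 0, 1}. (\<Sum>i<l. walk N u a l S k G (v + (s * a) *\<^sub>R u (S i)))
        + (\<integral>\<^sup>+z. walk N u a l S k G (v + (s * a) *\<^sub>R u z) \<partial>N))"

lemma walk_mono:
  assumes "\<And>v. G v \<le> H v"
  shows "walk N u a l S k G v \<le> walk N u a l S k H v"
proof (induction k arbitrary: v)
  case (Suc k)
  then show ?case
    unfolding walk.simps by (intro sum_mono add_mono nn_integral_mono)
qed (simp add: assms)

lemma norm_diff_add_scaleR:
  fixes w v x :: "'b::real_inner"
  shows "(norm (w - (v + c *\<^sub>R x)))\<^sup>2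
    = (norm (w - v))\<^sup>2 - 2 * c * ((w - v) \<bullet> x) + c\<^sup>2 * (norm x)\<^sup>2"
  unfolding power2_norm_eq_inner
  by (simp add: inner_diff_left inner_diff_right inner_add_left inner_add_right
      inner_commute power2_eq_square algebra_simps)

section \<open>Discrete product measures and the expected weight of a walk\<close>

text \<open>Countability of \<open>'d\<close> and the full power set as sigma-algebra make every
  function on a finite product measurable. So neither \<open>walk\<close> nor an event that
  quantifies over uncountably many \<open>w\<close> raises a measurability question.\<close>

locale discrete_prob = prob_space N for N :: "'d::countable measure" +
  assumes sets_N: "sets N = UNIV"
begin

lemma space_N [simp]: "space N = UNIV"
  using sets_N sets.sets_into_space sets.top by blast

lemma emeasure_N_UNIV [simp]: "emeasure N UNIV = 1"
  using emeasure_space_1 by simp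

lemma measurable_N [simp]: "f \<in> measurable N M \<longleftrightarrow> f \<in> UNIV \<rightarrow> space M"
  by (auto simp: measurable_def sets_N)

lemma sets_PiM_N: 
  assumes "finite J"
  shows "sets (PiM J (\<lambda>_. N)) = Pow (PiE J (\<lambda>_. UNIV))"
proof -
  have "sets (PiM J (\<lambda>_. N)) = sets (PiM J (\<lambda>_. count_space UNIV))"
    by (rule sets_PiM_cong) (auto simp: sets_N)
  also have "\<dots> = Pow (PiE J (\<lambda>_. UNIV))"
    using assms by (subst count_space_PiM_finite) auto
  finally show ?thesis .
qed

lemma measurable_PiM_N [simp]:
  fixes f :: "_ \<Rightarrow> ennreal"
  assumes "finite J"
  shows "f \<in> borel_measurable (PiM J (\<lambda>_. N))"
  by (auto simp: measurable_def sets_PiM_N[OF assms] space_PiM)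

sublocale P: product_prob_space "\<lambda>_::nat. N"
  by unfold_locales

lemma Fubini_N:
  fixes f :: "(nat \<Rightarrow> 'd) \<Rightarrow> 'd \<Rightarrow> ennreal"
  assumes "finite J"
  shows "(\<integral>\<^sup>+x. \<integral>\<^sup>+z. f x z \<partial>N \<partial>PiM J (\<lambda>_. N)) = (\<integral>\<^sup>+z. \<integral>\<^sup>+x. f x z \<partial>PiM J (\<lambda>_. N) \<partial>N)"
proof -
  interpret J: prob_space "PiM J (\<lambda>_. N)" by (rule prob_space_PiM) unfold_locales
  interpret Q: pair_sigma_finite N "PiM J (\<lambda>_. N)" by unfold_locales
  have "sets (N \<Otimes>\<^sub>M PiM J (\<lambda>_. N)) = sets (count_space UNIV \<Otimes>\<^sub>M PiM J (\<lambda>_. N))"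
    by (intro sets_pair_measure_cong) (auto simp: sets_N)
  \<comment> \<open>With a countable first factor, joint measurability reduces to measurability in
    \<open>x\<close> for each fixed \<open>z\<close>.\<close>
  moreover have "(\<lambda>(z, x). f x z) \<in> borel_measurable (count_space UNIV \<Otimes>\<^sub>M PiM J (\<lambda>_. N))"
    using assms by (intro measurable_pair_measure_countable1) auto
  ultimately have "(\<lambda>(z, x). f x z) \<in> borel_measurable (N \<Otimes>\<^sub>M PiM J (\<lambda>_. N))"
    by (simp cong: measurable_cong_sets)
  then show ?thesis
    by (intro Q.Fubini') simp
qed

text \<open>
  The coordinates outside \<open>J\<close>, fixed by \<open>T\<close>, are the sample points already visited. Each step
  of the walk moves at most one index out of \<open>J\<close>.
\<close>

lemma nn_integral_walk_le:
  fixes good :: "'b::real_inner \<Rightarrow> 'd set" and q :: ennreal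
  assumes "finite J" "q \<le> 1"
  shows "(\<integral>\<^sup>+f. walk N u a l (override_on T f J) k
             (\<lambda>v. of_bool ((\<forall>i\<in>J. f i \<in> good v) \<and> emeasure N (good v) \<le> q)) v \<partial>PiM J (\<lambda>_. N))
          \<le> of_nat (3 * (l + 1)) ^ k * q ^ (card J - k)"
  using assms(1)
proof (induction k arbitrary: J T v)
  case 0
  have "(\<integral>\<^sup>+f. of_bool ((\<forall>i\<in>J. f i \<in> good v) \<and> emeasure N (good v) \<le> q) \<partial>PiM J (\<lambda>_. N))
      \<le> q ^ card J"
  proof (cases "emeasure N (good v) \<le> q")
    case True
    have "(\<integral>\<^sup>+f. of_bool ((\<forall>i\<in>J. f i \<in> good v) \<and> emeasure N (good v) \<le> q) \<partial>PiM J (\<lambda>_. N))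
       = (\<integral>\<^sup>+f. indicator (PiE J (\<lambda>_. good v)) f \<partial>PiM J (\<lambda>_. N))"
      using True by (intro nn_integral_cong) (auto simp: indicator_def space_PiM PiE_iff)
    also have "\<dots> = emeasure (PiM J (\<lambda>_. N)) (PiE J (\<lambda>_. good v))"
      using 0 by (intro nn_integral_indicator) (auto simp: sets_PiM_N)
    also have "\<dots> = emeasure N (good v) ^ card J"
      using 0 by (subst P.emeasure_PiM) (auto simp: sets_N)
    also have "\<dots> \<le> q ^ card J"
      using True by (intro power_mono) auto
    finally show ?thesis .
  qed auto
  then show ?case by simp
next
  case (Suc k)
  define C :: ennreal where "C = of_nat (3 * (l + 1)) ^ k"
  define G where "G J f v = (of_bool ((\<forall>i\<in>J. f i \<in> good v) \<and> emeasure N (good v) \<le> q) :: ennreal)"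
    for J :: "nat set" and f v
  define B where "B = C * q ^ (card J - Suc k)"
  note fin [simp] = \<open>finite J\<close>
  have IH: "(\<integral>\<^sup>+f. walk N u a l (override_on T f J) k (G J f) v \<partial>PiM J (\<lambda>_. N))
      \<le> C * q ^ (card J - k)" if "finite J" for J T v
    using Suc.IH[OF that, of T v] unfolding G_def C_def .
  \<comment> \<open>Since \<open>q \<le> 1\<close>, the exponent \<open>card J - Suc k\<close> also
    covers the steps that use up no index of \<open>J\<close>.\<close>
  have qmono: "C * q ^ m \<le> C * q ^ n" if "n \<le> m" for m n
    using that \<open>q \<le> 1\<close> by (intro mult_left_mono power_decreasing) auto
  have const: "(\<integral>\<^sup>+f. walk N u a l (override_on T f J) k (G J f) v \<partial>PiM J (\<lambda>_. N)) \<le> B" for T v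
    unfolding B_def by (rule order_trans[OF IH qmono]) auto
  have ghost: "(\<integral>\<^sup>+f. (\<integral>\<^sup>+z. walk N u a l (override_on T f J) k (G J f) (v + c *\<^sub>R u z) \<partial>N)
      \<partial>PiM J (\<lambda>_. N)) \<le> B" for c
  proof -
    have "(\<integral>\<^sup>+z. (\<integral>\<^sup>+f. walk N u a l (override_on T f J) k (G J f) (v + c *\<^sub>R u z)
      \<partial>PiM J (\<lambda>_. N)) \<partial>N) \<le> (\<integral>\<^sup>+z. B \<partial>N)"
      by (intro nn_integral_mono const)
    then show ?thesis
      by (subst Fubini_N) auto
  qed
  have sample: "(\<integral>\<^sup>+f. walk N u a l (override_on T f J) k (G J f) (v + c *\<^sub>R u (override_on T f J i))
      \<partial>PiM J (\<lambda>_. N)) \<le> B" for c i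
  proof (cases "i \<in> J")
    case False
    then show ?thesis using const by simp
  next
    case True
    \<comment> \<open>A visit to \<open>i \<in> J\<close> fixes coordinate \<open>i\<close>: it
      becomes the outermost integral and moves from \<open>f\<close> into \<open>T\<close>, so that
      the induction hypothesis applies to \<open>J'\<close> for every value
      \<open>y\<close>.\<close>
    define J' where "J' = J - {i}"
    have J: "J = insert i J'" "i \<notin> J'" "finite J'" using True by (auto simp: J'_def)
    have ov: "override_on T (f(i := y)) J = override_on (T(i := y)) f J'" for f y
      using J(2) by (auto simp: override_on_def J(1))
    have "(\<integral>\<^sup>+f. walk N u a l (override_on T f J) k (G J f) (v + c *\<^sub>R u (override_on T f J i))
      \<partial>PiM J (\<lambda>_. N)) = (\<integral>\<^sup>+y. \<integral>\<^sup>+f. walk N u a l (override_on T (f(i := y)) J) k (G J (f(i := y)))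
         (v + c *\<^sub>R u (override_on T (f(i := y)) J i)) \<partial>PiM J' (\<lambda>_. N) \<partial>N)"
      unfolding J(1) using J(2,3) by (subst P.product_nn_integral_insert_rev) auto
    also have "\<dots> \<le> (\<integral>\<^sup>+y. \<integral>\<^sup>+f. walk N u a l (override_on (T(i := y)) f J') k (G J' f)
         (v + c *\<^sub>R u y) \<partial>PiM J' (\<lambda>_. N) \<partial>N)"
      unfolding ov
    proof (intro nn_integral_mono)
      fix y f
      have "override_on (T(i := y)) f J' i = y" using J(2) by simp
      \<comment> \<open>Dropping the requirement at \<open>i\<close> only enlarges the count, and
        the remaining ones do not involve \<open>y\<close>.\<close>
      moreover have "G J (f(i := y)) v \<le> G J' f v" for v
        using J by (auto simp: G_def)
      ultimately show "walk N u a l (override_on (T(i := y)) f J') k (G J (f(i := y)))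
           (v + c *\<^sub>R u (override_on (T(i := y)) f J' i))
         \<le> walk N u a l (override_on (T(i := y)) f J') k (G J' f) (v + c *\<^sub>R u y)"
        by (auto intro: walk_mono)
    qed
    also have "\<dots> \<le> (\<integral>\<^sup>+y. C * q ^ (card J' - k) \<partial>N)"
      by (intro nn_integral_mono IH J)
    also have "\<dots> = C * q ^ (card J' - k)"
      by simp
    also have "card J' - k = card J - Suc k"
      using J by simp
    finally show ?thesis unfolding B_def .
  qed
  have "(\<integral>\<^sup>+f. walk N u a l (override_on T f J) (Suc k) (G J f) v \<partial>PiM J (\<lambda>_. N))
     = (\<Sum>s\<in>{-1, 0, 1}. (\<Sum>i<l. \<integral>\<^sup>+f. walk N u a l (override_on T f J) k (G J f)
           (v + (s * a) *\<^sub>R u (override_on T f J i)) \<partial>PiM J (\<lambda>_. N))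
        + (\<integral>\<^sup>+f. (\<integral>\<^sup>+z. walk N u a l (override_on T f J) k (G J f) (v + (s * a) *\<^sub>R u z) \<partial>N)
             \<partial>PiM J (\<lambda>_. N)))"
    unfolding walk.simps by (simp only: nn_integral_add nn_integral_sum measurable_PiM_N fin)
  also have "\<dots> \<le> (\<Sum>s\<in>{-1, 0, 1::real}. (\<Sum>i<l. B) + B)"
    by (intro sum_mono add_mono sample ghost)
  \<comment> \<open>Three signs, each with \<open>l\<close> sample points and one fresh
    draw.\<close>
  also have "\<dots> = of_nat (3 * (l + 1)) * B"
    by (simp add: algebra_simps)
  also have "\<dots> = of_nat (3 * (l + 1)) ^ Suc k * q ^ (card J - Suc k)"
    by (simp add: B_def C_def mult.assoc)
  finally show ?case unfolding G_def .
qed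

section \<open>Lower bound for the weight, and the resulting tail bound\<close>

text \<open>The squared distance to \<open>w\<close> is measured in units of
  \<open>(g / R)\<^sup>2\<close>, of which at most \<open>k\<close> are left. A correcting step
  removes at least one unit; when only fresh draws can provide it, the weight loses a factor
  \<open>\<eta>\<close>.\<close>

lemma walk_ge:
  fixes u :: "'d \<Rightarrow> 'b::real_inner"
  assumes "0 < R" "0 < g" "0 \<le> \<eta>" "\<eta> \<le> 1"
    and u: "\<And>d. d \<in> B \<Longrightarrow> norm (u d) \<le> R"
    and G: "\<And>v. \<lbrakk>\<And>i. i < l \<Longrightarrow> S i \<in> B \<Longrightarrow> \<bar>(w - v) \<bullet> u (S i)\<bar> \<le> g;
                 measure N {d\<in>B. \<bar>(w - v) \<bullet> u d\<bar> > g} \<le> \<eta>\<rbrakk> \<Longrightarrow> 1 \<le> G v"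
    and "(norm (w - v))\<^sup>2 \<le> real k * (g / R)\<^sup>2"
  shows "ennreal \<eta> ^ k \<le> walk N u (g / R\<^sup>2) l S k G v"
  using assms(7)
proof (induction k arbitrary: v)
  case 0
  \<comment> \<open>With no unit left \<open>v\<close> equals \<open>w\<close>, so nothing is off
    and the mass in the premise on \<open>G\<close> is \<open>0\<close>.\<close>
  then have "w = v" by simp
  then show ?case using G[of v] assms by simp
next
  case (Suc k)
  have step: "ennreal \<eta> ^ k \<le> walk N u (g / R\<^sup>2) l S k G
       (v + (sgn ((w - v) \<bullet> u d) * (g / R\<^sup>2)) *\<^sub>R u d)"
    if "d \<in> B" and large: "\<bar>(w - v) \<bullet> u d\<bar> > g" for d
  proof (rule Suc.IH)
    define t where "t = (w - v) \<bullet> u d"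
    define a where "a = g / R\<^sup>2"
    have "0 < a" using assms by (simp add: a_def)
    have sg: "sgn t * t = \<bar>t\<bar>" "(sgn t)\<^sup>2 = 1"
      using large assms by (auto simp: t_def sgn_real_def power2_eq_square)
    have "(norm (w - (v + (sgn t * a) *\<^sub>R u d)))\<^sup>2
       = (norm (w - v))\<^sup>2 - 2 * a * (sgn t * t) + (sgn t)\<^sup>2 * a\<^sup>2 * (norm (u d))\<^sup>2"
      unfolding norm_diff_add_scaleR t_def by (simp add: power_mult_distrib)
    also have "\<dots> = (norm (w - v))\<^sup>2 - 2 * a * \<bar>t\<bar> + a\<^sup>2 * (norm (u d))\<^sup>2"
      by (simp add: sg)
    \<comment> \<open>The step length \<open>g / R\<^sup>2\<close> minimises
      \<open>- 2 * a * g + a\<^sup>2 * R\<^sup>2\<close>, with minimum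
      \<open>- (g / R)\<^sup>2\<close>.\<close>
    also have "\<dots> \<le> (norm (w - v))\<^sup>2 - 2 * a * g + a\<^sup>2 * R\<^sup>2"
      using large u[OF that(1)] \<open>0 < a\<close> unfolding t_def
      by (intro add_mono diff_mono mult_left_mono power_mono) auto
    also have "\<dots> = (norm (w - v))\<^sup>2 - (g / R)\<^sup>2"
      using assms by (simp add: a_def power2_eq_square field_simps)
    also have "\<dots> \<le> real k * (g / R)\<^sup>2"
      using Suc.prems by (simp add: algebra_simps)
    finally show "(norm (w - (v + (sgn ((w - v) \<bullet> u d) * (g / R\<^sup>2)) *\<^sub>R u d)))\<^sup>2
       \<le> real k * (g / R)\<^sup>2"
      unfolding t_def a_def .
  qed
  define W where "W s x = walk N u (g / R\<^sup>2) l S k G (v + (s * (g / R\<^sup>2)) *\<^sub>R u x)" for s x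
  have Wsuc: "walk N u (g / R\<^sup>2) l S (Suc k) G v
     = (\<Sum>s\<in>{-1, 0, 1}. (\<Sum>i<l. W s (S i)) + (\<integral>\<^sup>+z. W s z \<partial>N))"
    unfolding W_def by simp
  define D where "D = {d\<in>B. \<bar>(w - v) \<bullet> u d\<bar> > g}"
  have sgn_in: "sgn ((w - v) \<bullet> u d) \<in> {-1, 0, 1}" for d by (auto simp: sgn_real_def)
  have \<eta>k: "ennreal \<eta> ^ Suc k \<le> ennreal \<eta> ^ k" "ennreal \<eta> ^ Suc k \<le> 1"
    using \<open>\<eta> \<le> 1\<close> by (auto intro!: mult_left_le_one_le power_decreasing power_le_one simp del: power_Suc)
  consider (sample) i where "i < l" "S i \<in> D" | (mass) "measure N D > \<eta>"
    | (close) "\<And>i. i < l \<Longrightarrow> S i \<notin> D" "measure N D \<le> \<eta>"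
    by fastforce
  then show ?case
  proof cases
    case sample
    define s where "s = sgn ((w - v) \<bullet> u (S i))"
    have "ennreal \<eta> ^ k \<le> W s (S i)"
      using step[of "S i"] sample(2) by (auto simp: D_def W_def s_def)
    also have "\<dots> \<le> (\<Sum>i<l. W s (S i))"
      using sample(1) by (intro member_le_sum) auto
    also have "\<dots> \<le> (\<Sum>i<l. W s (S i)) + (\<integral>\<^sup>+z. W s z \<partial>N)" by simp
    also have "\<dots> \<le> walk N u (g / R\<^sup>2) l S (Suc k) G v"
      unfolding Wsuc using sgn_in[of "S i"] 
      by (intro member_le_sum[of s "{-1,0,1}" "\<lambda>s. (\<Sum>i<l. W s (S i)) + (\<integral>\<^sup>+z. W s z \<partial>N)"]) 
         (auto simp: s_def)
    finally show ?thesis using \<eta>k by (meson order_trans)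
  next
    case mass
    have "ennreal \<eta> ^ Suc k \<le> ennreal \<eta> ^ k * emeasure N D"
      using mass unfolding power_Suc2 emeasure_eq_measure
      by (intro mult_left_mono ennreal_leI) auto
    also have "\<dots> = (\<integral>\<^sup>+z. ennreal \<eta> ^ k * indicator D z \<partial>N)"
      by (simp add: nn_integral_cmult_indicator sets_N)
    also have "\<dots> \<le> (\<integral>\<^sup>+z. (\<Sum>s\<in>{-1, 0, 1}. W s z) \<partial>N)"
    proof (intro nn_integral_mono)
      fix z
      show "ennreal \<eta> ^ k * indicator D z \<le> (\<Sum>s\<in>{-1, 0, 1}. W s z)"
      proof (cases "z \<in> D")
        case True
        have "ennreal \<eta> ^ k \<le> W (sgn ((w - v) \<bullet> u z)) z"
          using step[of z] True by (auto simp: D_def W_def)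
        also have "\<dots> \<le> (\<Sum>s\<in>{-1, 0, 1}. W s z)"
          using sgn_in[of z] by (intro member_le_sum) auto
        finally show ?thesis using True by simp
      qed simp
    qed
    also have "\<dots> = (\<Sum>s\<in>{-1, 0, 1}. (\<integral>\<^sup>+z. W s z \<partial>N))"
      by (intro nn_integral_sum) simp
    also have "\<dots> \<le> walk N u (g / R\<^sup>2) l S (Suc k) G v"
      unfolding Wsuc by (intro sum_mono) simp
    finally show ?thesis .
  next
    case close
    have "1 \<le> walk N u (g / R\<^sup>2) l S m G v" for m
    proof (induction m)
      case 0
      show ?case using close by (auto intro!: G simp: D_def not_less)
    next
      case (Suc m)
      have "1 \<le> (\<integral>\<^sup>+z. walk N u (g / R\<^sup>2) l S m G v \<partial>N)"
        using Suc by simp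
      also have "\<dots> \<le> walk N u (g / R\<^sup>2) l S (Suc m) G v"
        by (simp add: add.assoc add_increasing2 add_increasing)
      finally show ?case .
    qed
    then show ?thesis using \<eta>k by (meson order_trans)
  qed
qed

text \<open>Three thresholds are used on \<open>B\<close>: \<open>w \<bullet> u d\<close> is at
  least \<open>3 * g\<close> on the sample, so for a close \<open>v\<close> the value is at least
  \<open>2 * g\<close> there; and where \<open>w \<bullet> u d < g\<close>, the value for
  \<open>v\<close> is below \<open>2 * g\<close> except on mass \<open>\<eta>\<close>. Hence
  \<open>good v\<close> contains the sample but has mass at most
  \<open>1 - (e - \<eta>)\<close>.\<close>

lemma prob_large_risk_le:
  fixes u :: "'d \<Rightarrow> 'b::real_inner"
  assumes "0 < R" "0 < g" "0 < \<eta>" "\<eta> \<le> 1" "e - \<eta> \<le> 1" "\<eta> \<le> e"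
    and u: "\<And>d. d \<in> B \<Longrightarrow> norm (u d) \<le> R"
    and K: "M * (R / g)\<^sup>2 \<le> real K"
  shows "measure (PiM {..<l} (\<lambda>_. N)) {S \<in> space (PiM {..<l} (\<lambda>_. N)).
            \<exists>w. (norm w)\<^sup>2 \<le> M \<and> (\<forall>i<l. S i \<in> B \<longrightarrow> 3 * g \<le> w \<bullet> u (S i)) \<and>
                e < measure N {d\<in>B. w \<bullet> u d < g}}
         \<le> (3 * (real l + 1) / \<eta>) ^ K * (1 - (e - \<eta>)) ^ (l - K)" (is "measure ?P ?X \<le> _")
proof -
  interpret L: prob_space ?P by (rule prob_space_PiM) unfold_locales
  define good where "good v = {d. d \<in> B \<longrightarrow> 2 * g \<le> v \<bullet> u d}" for v
  define q where "q = ennreal (1 - (e - \<eta>))"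
  define G where "G f v = (of_bool ((\<forall>i\<in>{..<l}. f i \<in> good v) \<and> emeasure N (good v) \<le> q) :: ennreal)" 
    for f v
  define F where "F f = walk N u (g / R\<^sup>2) l f K (G f) 0" for f
  have "ennreal \<eta> ^ K \<le> F S" if "S \<in> ?X" for S
  proof -
    from that obtain w where w: "(norm w)\<^sup>2 \<le> M" "\<And>i. i < l \<Longrightarrow> S i \<in> B \<Longrightarrow> 3 * g \<le> w \<bullet> u (S i)"
      "e < measure N {d\<in>B. w \<bullet> u d < g}" by auto
    show ?thesis unfolding F_def
    proof (rule walk_ge[OF assms(1,2) _ assms(4) u, where w = w])
      fix v 
      assume v: "\<And>i. i < l \<Longrightarrow> S i \<in> B \<Longrightarrow> \<bar>(w - v) \<bullet> u (S i)\<bar> \<le> g"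
        "measure N {d\<in>B. \<bar>(w - v) \<bullet> u d\<bar> > g} \<le> \<eta>"
      have "S i \<in> good v" if "i < l" for i
        using v(1)[OF that] w(2)[OF that] by (auto simp: good_def inner_diff_left)
      moreover have "emeasure N (good v) \<le> q"
      proof -
        have "{d\<in>B. w \<bullet> u d < g} \<subseteq> (UNIV - good v) \<union> {d\<in>B. \<bar>(w - v) \<bullet> u d\<bar> > g}"
          by (auto simp: good_def inner_diff_left)
        then have "measure N {d\<in>B. w \<bullet> u d < g} \<le> measure N ((UNIV - good v) \<union> {d\<in>B. \<bar>(w - v) \<bullet> u d\<bar> > g})"
          by (intro finite_measure_mono) (auto simp: sets_N)
        also have "\<dots> \<le> measure N (UNIV - good v) + measure N {d\<in>B. \<bar>(w - v) \<bullet> u d\<bar> > g}"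
          by (intro measure_Un_le) (auto simp: sets_N)
        finally have "e - \<eta> \<le> measure N (UNIV - good v)" using w(3) v(2) by simp
        also have "\<dots> = 1 - measure N (good v)"
          using prob_compl[of "good v"] by (simp add: sets_N)
        finally show ?thesis
          unfolding q_def emeasure_eq_measure by (intro ennreal_leI) simp
      qed
      ultimately show "1 \<le> G S v" by (simp add: G_def)
    next
      have "(norm w)\<^sup>2 \<le> M * ((R / g)\<^sup>2 * (g / R)\<^sup>2)"
        using w assms by (simp add: power_mult_distrib[symmetric])
      also have "\<dots> \<le> real K * (g / R)\<^sup>2"
        using K by (simp add: mult_right_mono mult.assoc[symmetric])
      finally show "(norm (w - 0))\<^sup>2 \<le> real K * (g / R)\<^sup>2" by simp
    qed (use assms in auto)
  qed
  \<comment> \<open>Markov's inequality for \<open>F\<close>, rescaled so that the threshold is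
    \<open>1\<close>.\<close>
  then have "?X \<subseteq> {S\<in>space ?P. 1 \<le> ennreal (1 / \<eta> ^ K) * F S}"
  proof (intro subsetI CollectI conjI)
    fix S assume S: "S \<in> ?X"
    have "1 = ennreal (1 / \<eta> ^ K) * ennreal \<eta> ^ K"
      using assms by (simp add: ennreal_power ennreal_mult[symmetric])
    also have "\<dots> \<le> ennreal (1 / \<eta> ^ K) * F S"
      using \<open>\<And>S. S \<in> ?X \<Longrightarrow> ennreal \<eta> ^ K \<le> F S\<close>[OF S] by (intro mult_left_mono) auto
    finally show "1 \<le> ennreal (1 / \<eta> ^ K) * F S" .
  qed auto
  then have "emeasure ?P ?X \<le> emeasure ?P {S\<in>space ?P. 1 \<le> ennreal (1 / \<eta> ^ K) * F S}"
    by (intro emeasure_mono) (auto simp: sets_PiM_N space_PiM)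
  also have "\<dots> \<le> ennreal (1 / \<eta> ^ K) * (\<integral>\<^sup>+S. F S * indicator (space ?P) S \<partial>?P)"
    by (intro nn_integral_Markov_inequality) auto
  also have "(\<integral>\<^sup>+S. F S * indicator (space ?P) S \<partial>?P) = (\<integral>\<^sup>+S. F S \<partial>?P)"
    by (intro nn_integral_cong) auto
  \<comment> \<open>All indices start out unvisited; the default \<open>undefined\<close> agrees
    with the extensionality of points of the product space.\<close>
  also have "\<dots> = (\<integral>\<^sup>+f. walk N u (g / R\<^sup>2) l (override_on (\<lambda>_. undefined) f {..<l}) K (G f) 0 \<partial>?P)"
  proof (intro nn_integral_cong)
    fix f assume "f \<in> space ?P"
    then have "override_on (\<lambda>_. undefined) f {..<l} = f"
      by (auto simp: space_PiM override_on_def PiE_iff extensional_def)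
    then show "F f = walk N u (g / R\<^sup>2) l (override_on (\<lambda>_. undefined) f {..<l}) K (G f) 0"
      by (simp add: F_def)
  qed
  also have "\<dots> \<le> of_nat (3 * (l + 1)) ^ K * q ^ (card {..<l} - K)"
    unfolding G_def using assms by (intro nn_integral_walk_le) (auto simp: q_def)
  also have "ennreal (1 / \<eta> ^ K) * (of_nat (3 * (l + 1)) ^ K * q ^ (card {..<l} - K))
    = ennreal ((3 * (real l + 1) / \<eta>) ^ K * (1 - (e - \<eta>)) ^ (l - K))"
  proof -
    have "of_nat (3 * (l + 1)) ^ K = ennreal (real (3 * (l + 1)) ^ K)"
      by (simp only: ennreal_of_nat_eq_real_of_nat ennreal_power of_nat_0_le_iff)
    moreover have "q ^ (l - K) = ennreal ((1 - (e - \<eta>)) ^ (l - K))"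
      using assms by (simp add: q_def ennreal_power)
    moreover have "3 * (real l + 1) = real (3 * (l + 1))" by simp
    ultimately show ?thesis
      using assms by (simp only:) (simp add: power_divide del: of_nat_mult of_nat_add flip: ennreal_mult)
  qed
  finally show ?thesis
    using assms by (simp add: L.emeasure_eq_measure add.commute mult_left_mono)
qed

end

section \<open>Hyperplanes and margins\<close>

lemma infdist_hyperplane:
  assumes "w \<noteq> 0"
  shows "infdist x (hyperplane w b) = \<bar>w \<bullet> x + b\<bar> / norm w"
proof -
  \<comment> \<open>The foot of the perpendicular from \<open>x\<close>.\<close>
  define p where "p = x - ((w \<bullet> x + b) / (norm w)\<^sup>2) *\<^sub>R w"
  have p: "p \<in> hyperplane w b"
    using assms by (simp add: p_def hyperplane_def inner_diff_right flip: power2_norm_eq_inner)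
  have dist_p: "dist x p = \<bar>w \<bullet> x + b\<bar> / norm w"
    using assms by (simp add: p_def dist_norm power2_eq_square)
  have lower: "\<bar>w \<bullet> x + b\<bar> / norm w \<le> dist x z" if "z \<in> hyperplane w b" for z
  proof -
    have "w \<bullet> x + b = w \<bullet> (x - z)"
      using that by (simp add: hyperplane_def inner_diff_right)
    also have "\<bar>\<dots>\<bar> \<le> norm w * norm (x - z)" by (rule Cauchy_Schwarz_ineq2)
    finally show ?thesis using assms by (simp add: dist_norm field_simps)
  qed
  show ?thesis
  proof (rule antisym)
    show "infdist x (hyperplane w b) \<le> \<bar>w \<bullet> x + b\<bar> / norm w"
      using infdist_le[OF p, of x] dist_p by simp
    have "\<bar>w \<bullet> x + b\<bar> / norm w \<le> (INF z\<in>hyperplane w b. dist x z)"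
      using p lower by (intro cINF_greatest) blast+
    also have "\<dots> = infdist x (hyperplane w b)"
      using p by (subst infdist_notempty) blast+
    finally show "\<bar>w \<bullet> x + b\<bar> / norm w \<le> infdist x (hyperplane w b)" .
  qed
qed

lemma side_neq_iff:
  assumes "t \<in> {-1, 1}"
  shows "side w b x \<noteq> t \<longleftrightarrow> t * (w \<bullet> x + b) \<le> 0"
  using assms by (auto simp: side_def sgn_real_def)

lemma signed_margin_ge:
  assumes "w \<noteq> 0" "classifies y l x w b" "\<Delta> \<le> margin l x w b" "i < l" "y (x i) \<in> {-1, 1}"
  shows "\<Delta> * norm w \<le> y (x i) * (w \<bullet> x i + b)"
proof -
  have "margin l x w b \<le> infdist (x i) (hyperplane w b)"
    unfolding margin_def using assms by (intro Min_le) auto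
  then have "\<Delta> \<le> \<bar>w \<bullet> x i + b\<bar> / norm w"
    using assms by (simp add: infdist_hyperplane)
  then have "\<Delta> * norm w \<le> \<bar>w \<bullet> x i + b\<bar>"
    using assms by (simp add: field_simps)
  also have "\<dots> = y (x i) * (w \<bullet> x i + b)"
    using assms(2,4,5) side_neq_iff[of "y (x i)" w b "x i"]
    by (auto simp: classifies_def)
  finally show ?thesis .
qed

text \<open>With a single label, shifting the hyperplane away from the sample increases the margin.\<close>

lemma max_margin_hyperplane_both_labels:
  assumes "max_margin_hyperplane y l x w b" "0 < l" "c \<in> {-1, 1}"
  shows "\<exists>i<l. y (x i) \<noteq> c"
proof (rule ccontr)
  assume "\<not> ?thesis"
  then have c: "y (x i) = c" if "i < l" for i using that by auto
  from assms(1) have w: "w \<noteq> 0" "classifies y l x w b"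
    and max: "\<And>w' b'. \<lbrakk>w' \<noteq> 0; classifies y l x w' b'\<rbrakk> \<Longrightarrow> margin l x w' b' \<le> margin l x w b"
    by (auto simp: max_margin_hyperplane_def)
  \<comment> \<open>This moves the hyperplane by one unit of length away from the sample, so every
    distance grows by \<open>1\<close>.\<close>
  define b' where "b' = b + c * norm w"
  have pos: "0 < c * (w \<bullet> x i + b)" if "i < l" for i
    using w(2) that side_neq_iff[OF assms(3), of w b "x i"] c[OF that] by (auto simp: classifies_def)
  have shift: "c * (w \<bullet> x i + b') = c * (w \<bullet> x i + b) + norm w" for i
    using assms(3) by (auto simp: b'_def algebra_simps)
  have "classifies y l x w b'"
    unfolding classifies_def
  proof (intro allI impI)
    fix i assume "i < l"
    then have "0 < c * (w \<bullet> x i + b')"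
      using pos[of i] w(1) unfolding shift by (intro add_pos_pos) auto
    then show "side w b' (x i) = y (x i)"
      using side_neq_iff[OF assms(3), of w b' "x i"] c[OF \<open>i < l\<close>] by auto
  qed
  then have "margin l x w b' \<le> margin l x w b" using max w by blast
  moreover have "margin l x w b' \<in> (\<lambda>i. infdist (x i) (hyperplane w b')) ` {..<l}"
    unfolding margin_def using assms(2) by (intro Min_in) auto
  then obtain i where i: "i < l" "margin l x w b' = infdist (x i) (hyperplane w b')" by auto
  moreover have "margin l x w b \<le> infdist (x i) (hyperplane w b)"
    unfolding margin_def using i by (intro Min_le) auto
  moreover have "\<bar>w \<bullet> x i + b'\<bar> = \<bar>w \<bullet> x i + b\<bar> + norm w"
    using shift[of i] pos[OF i(1)] assms(3) norm_ge_zero[of w]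
    by (smt (verit) empty_iff insert_iff mult_cancel_right1 mult_minus_left)
  ultimately show False
    using w(1) by (simp add: infdist_hyperplane add_divide_distrib)
qed

section \<open>Exceptional events, the numerical tail bound, and offsets\<close>

lemma with_prob_geI:
  assumes "prob_space M" "X \<in> sets M" "measure M X \<le> \<delta>" "\<And>x. x \<in> space M - X \<Longrightarrow> Q x"
  shows "with_prob_ge M (1 - \<delta>) Q"
  unfolding with_prob_ge_def
proof (intro bexI conjI ballI)
  show "1 - \<delta> \<le> measure M (space M - X)"
    using assms prob_space.prob_compl[of M X] by simp
qed (use assms in auto)

text \<open>The choice \<open>\<eta> = 1 / l\<close> turns the count into
  \<open>(3 * (l + 1) * l) ^ K\<close>, whose logarithm is at most
  \<open>3 * K * (1 + ln l)\<close>; the factor \<open>10000\<close> in \<open>X\<close> exceeds all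
  constants that arise. The summand \<open>- D\<close> in \<open>e\<close> leaves room for the mass
  outside the ball.\<close>

lemma union_bound_le:
  fixes D t \<Delta> :: real and l K :: nat
  defines "X \<equiv> 10000 * D * (1 + ln (real l))"
  assumes "1 \<le> l" "1 / 8 \<le> D" "0 < t" "real K \<le> 576 * D + 1" "X + t < real l"
  defines "e \<equiv> (X + t - D) / real l"
  shows "(3 * (real l + 1) * real l) ^ K * (1 - (e - 1 / real l)) ^ (l - K) \<le> exp (- t)"
    and "1 / real l \<le> e" "e \<le> 1"
proof -
  have L: "0 \<le> ln (real l)" using assms by simp
  have DL: "D \<le> D * (1 + ln (real l))" using L assms by (simp add: algebra_simps)
  \<comment> \<open>\<open>1 \<le> 8 * D\<close> absorbs the rounding term of
    \<open>K\<close>.\<close>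
  have K: "real K \<le> 584 * D" using assms by linarith
  have KX: "real K \<le> X" "D + 1 \<le> X" using K DL assms unfolding X_def by linarith+
  have Kl: "K \<le> l" using KX assms by simp
  show e: "1 / real l \<le> e" "e \<le> 1"
    using KX assms by (auto simp: e_def field_simps)
  define z where "z = e - 1 / real l"
  have z: "0 \<le> z" "z \<le> 1" using e assms(2) unfolding z_def by (auto intro: order_trans[OF _ e(2)])
  have zl: "z * real l = X + t - D - 1" using assms by (simp add: z_def e_def field_simps)
  have "3 * (real l + 1) * real l \<le> 6 * (real l)\<^sup>2"
    using assms by (simp add: power2_eq_square)
  also have "\<dots> \<le> exp 3 * exp (2 * ln (real l))"
  proof (intro mult_mono)
    show "(6::real) \<le> exp 3" using exp_lower_Taylor_quadratic[of 3] by simp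
    show "(real l)\<^sup>2 \<le> exp (2 * ln (real l))"
      using assms by (simp add: exp_double)
  qed auto
  also have "\<dots> = exp (3 + 2 * ln (real l))" by (simp add: exp_add)
  also have "\<dots> \<le> exp (3 * (1 + ln (real l)))" using L by simp
  finally have "(3 * (real l + 1) * real l) ^ K \<le> exp (3 * (1 + ln (real l))) ^ K"
    by (intro power_mono) auto
  moreover have "exp (3 * (1 + ln (real l))) ^ K \<le> exp (1752 * (D * (1 + ln (real l))))"
    using mult_right_mono[OF K, of "1 + ln (real l)"] L
    by (simp add: exp_of_nat_mult[symmetric] algebra_simps)
  moreover have "(1 - z) ^ (l - K) \<le> exp (- (X + t - D - 1 - real K))"
  proof -
    have "(1 - z) ^ (l - K) \<le> exp (- z) ^ (l - K)"
      using z exp_ge_add_one_self[of "- z"] by (intro power_mono) auto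
    also have "\<dots> = exp (- (z * real l - z * real K))"
      using Kl by (simp add: exp_of_nat_mult[symmetric] of_nat_diff algebra_simps)
    \<comment> \<open>As \<open>z \<le> 1\<close>, the \<open>K\<close> missing factors cost at most
      \<open>K\<close> in the exponent.\<close>
    also have "\<dots> \<le> exp (- (X + t - D - 1 - real K))"
      using z zl mult_left_le_one_le[of "real K" z] by simp
    finally show ?thesis .
  qed
  ultimately have "(3 * (real l + 1) * real l) ^ K * (1 - z) ^ (l - K)
      \<le> exp (1752 * (D * (1 + ln (real l)))) * exp (- (X + t - D - 1 - real K))"
    using z by (intro mult_mono) auto
  also have "\<dots> = exp (1752 * (D * (1 + ln (real l))) - (X + t - D - 1 - real K))"
    by (simp add: exp_add[symmetric])
  also have "\<dots> \<le> exp (- t)"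
  proof -
    \<comment> \<open>The terms to absorb are \<open>1752 * (D * (1 + ln l))\<close> and
      \<open>D + 1 + K \<le> 593 * D\<close>.\<close>
    have "X = 10000 * (D * (1 + ln (real l)))" by (simp add: X_def)
    then have "1752 * (D * (1 + ln (real l))) - (X + t - D - 1 - real K) \<le> - t"
      using K DL assms(3) by linarith
    then show ?thesis by (simp only: exp_le_cancel_iff)
  qed
  finally show "(3 * (real l + 1) * real l) ^ K * (1 - (e - 1 / real l)) ^ (l - K) \<le> exp (- t)"
    unfolding z_def .
qed

text \<open>For \<open>h = w \<bullet> x\<close> with \<open>x\<close> in the ball of radius \<open>R\<close>, clamping the offset is harmless.\<close>

lemma clamp_signed_ge:
  fixes t h \<beta> R \<Delta> :: real
  defines "\<beta>' \<equiv> max (- (R + \<Delta>)) (min (R + \<Delta>) \<beta>)"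
  assumes "t \<in> {-1, 1}" "\<bar>h\<bar> \<le> R" "0 < \<Delta>"
  shows "\<Delta> \<le> t * (h + \<beta>) \<Longrightarrow> \<Delta> \<le> t * (h + \<beta>')"
    and "t * (h + \<beta>) \<le> 0 \<Longrightarrow> t * (h + \<beta>') \<le> 0"
  using assms(2-4) unfolding \<beta>'_def by (auto simp: max_def min_def)

section \<open>The labelled distribution and its samples\<close>

locale labelled_distribution = prob_space P for P :: "'a::real_inner measure" +
  fixes y :: "'a \<Rightarrow> real" and r :: real
  assumes sets_P: "sets P = sets borel"
    and sep: "separably_supported P"
    and y_meas [measurable]: "y \<in> borel_measurable P"
    and y_range: "y x \<in> {-1, 1}"
    and r_nonneg: "0 \<le> r"
    and sq_int: "integrable P (\<lambda>x. (norm x)\<^sup>2)"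
    and sq_eq: "(\<integral>x. (norm x)\<^sup>2 \<partial>P) = r\<^sup>2"
begin

lemma space_P [simp]: "space P = UNIV"
  using sets_eq_imp_space_eq[OF sets_P] by simp

lemma continuous_measurable_P: "continuous_on UNIV f \<Longrightarrow> f \<in> borel_measurable P" for f
  using measurable_cong_sets[OF sets_P refl] borel_measurable_continuous_onI by blast

lemma measurable_P [measurable]:
  "(\<lambda>z. w \<bullet> z) \<in> borel_measurable P" "(\<lambda>z. norm z) \<in> borel_measurable P"
  "(\<lambda>z. dist z p) \<in> borel_measurable P"
  by (intro continuous_measurable_P continuous_intros)+

lemma prob_norm_ge:
  assumes "0 < a"
  shows "prob {z. a \<le> norm z} \<le> r\<^sup>2 / a\<^sup>2"
proof -
  have "prob {z \<in> space P. a\<^sup>2 \<le> (norm z)\<^sup>2} \<le> (\<integral>z. (norm z)\<^sup>2 \<partial>P) / a\<^sup>2"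
    using assms by (intro integral_Markov_inequality_measure[where A = "{}"] sq_int) auto
  then show ?thesis using assms by (simp add: sq_eq power2_le_iff_abs_le)
qed

lemma risk_le_1: "risk P y w b \<le> 1"
  by (simp add: risk_def)

lemma risk_eq: "risk P y w b = prob {z. y z * (w \<bullet> z + b) \<le> 0}"
  unfolding risk_def by (simp add: side_neq_iff[OF y_range])

lemma prob_space_sample: "prob_space (PiM {..<l} (\<lambda>_. P))"
  by (intro prob_space_PiM) unfold_locales

end

lemma measure_PiM_PiE:
  fixes A :: "nat \<Rightarrow> 'a set"
  assumes "prob_space P" "\<And>i. i < l \<Longrightarrow> A i \<in> sets P"
  shows "PiE {..<l} A \<in> sets (PiM {..<l} (\<lambda>_. P))"
    and "measure (PiM {..<l} (\<lambda>_. P)) (PiE {..<l} A) = (\<Prod>i<l. measure P (A i))"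
proof -
  interpret prob_space P by fact
  interpret finite_product_prob_space "\<lambda>_::nat. P" "{..<l}" by unfold_locales auto
  show "PiE {..<l} A \<in> sets (PiM {..<l} (\<lambda>_. P))"
    using assms by (intro sets_PiM_I_finite) auto
  show "measure (PiM {..<l} (\<lambda>_. P)) (PiE {..<l} A) = (\<Prod>i<l. measure P (A i))"
    using assms(2) by (intro finite_measure_PiM_emb) auto
qed

context labelled_distribution
begin

section \<open>Small ratio: a direct union bound\<close>

text \<open>
  If \<open>D\<close> is small, sample points of norm at least \<open>\<Delta> / 2\<close> are rare, yet a maximum margin
  hyperplane can only exist if there is one. A hyperplane that keeps distance \<open>\<Delta>\<close> from a
  sample point of norm less than \<open>\<Delta> / 2\<close> does not cut the ball of radius \<open>\<Delta> / 2\<close>.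
\<close>

lemma small_ratio:
  fixes \<Delta> t :: real and l :: nat
  defines "D \<equiv> r * sqrt (real l) / \<Delta>"
  assumes "0 < \<Delta>" "1 \<le> l" "D \<le> 1 / 8" "0 < t" "t < real l"
  shows "with_prob_ge (PiM {..<l} (\<lambda>_. P)) (1 - exp (- t))
    (\<lambda>x. \<forall>w b. max_margin_hyperplane y l x w b \<and> \<Delta> \<le> margin l x w b
       \<longrightarrow> risk P y w b \<le> (D + t) / real l)"
proof -
  let ?M = "PiM {..<l} (\<lambda>_. P)"
  interpret M: prob_space ?M by (rule prob_space_sample)
  define Out where "Out = {z :: 'a. \<Delta> / 2 \<le> norm z}"
  define Wrong where "Wrong c = {z :: 'a. norm z < \<Delta> / 2 \<and> y z \<noteq> c}" for c :: real
  \<comment> \<open>The labels in \<open>C\<close> are those whose constant classifier fails too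
    often on the inner ball. The exceptional event \<open>X\<close> says that all points lie outside
    that ball, or that, for some label in \<open>C\<close>, one point does and no other point
    reveals a wrong label.\<close>
  define C where "C = {c \<in> {-1, 1}. t / real l < prob (Wrong c)}"
  define Box where "Box c i = PiE {..<l} (\<lambda>j. if j = i then Out else UNIV - Wrong c)" for c i
  define X where "X = PiE {..<l} (\<lambda>_. Out) \<union> (\<Union>c\<in>C. \<Union>i<l. Box c i)"
  have meas [measurable]: "Out \<in> sets P" "Wrong c \<in> sets P" for c
  proof -
    have "{z \<in> space P. \<Delta> / 2 \<le> norm z} \<in> sets P" "{z \<in> space P. norm z < \<Delta> / 2 \<and> y z \<noteq> c} \<in> sets P"
      by measurable
    then show "Out \<in> sets P" "Wrong c \<in> sets P" by (simp_all add: Out_def Wrong_def)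
  qed
  have compl: "UNIV - Wrong c \<in> sets P" for c
    using sets.compl_sets[OF meas(2)[of c]] by simp
  have "finite C" "C \<subseteq> {-1, 1}" by (auto simp: C_def)
  have cardC: "card C \<le> 2"
    using card_mono[of "{-1, 1::real}" C] \<open>C \<subseteq> {-1, 1}\<close> by simp
  define q where "q = prob Out"
  have q0: "0 \<le> q" by (simp add: q_def)
  have "D \<ge> 0" using assms r_nonneg by (simp add: D_def)
  have D2: "D\<^sup>2 \<le> D / 8" "D\<^sup>2 \<le> 1 / 64"
    using mult_left_mono[OF assms(4) \<open>0 \<le> D\<close>] mult_mono[OF assms(4) assms(4)] \<open>0 \<le> D\<close>
    by (auto simp: power2_eq_square)
  have "q \<le> r\<^sup>2 / (\<Delta> / 2)\<^sup>2"
    unfolding q_def Out_def using assms by (intro prob_norm_ge) auto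
  also have "\<dots> = 4 * D\<^sup>2 / real l"
    using assms by (simp add: D_def power_mult_distrib power_divide field_simps)
  finally have q: "q \<le> 4 * D\<^sup>2 / real l" .
  have box: "M.prob (Box c i) \<le> q * (3 * exp (- t))" "Box c i \<in> sets ?M" if "c \<in> C" "i < l" for c i
  proof -
    have m: "(if j = i then Out else UNIV - Wrong c) \<in> sets P" for j
      using compl by auto
    show "Box c i \<in> sets ?M"
      unfolding Box_def using m by (intro measure_PiM_PiE prob_space_axioms)
    have "M.prob (Box c i) = (\<Prod>j<l. prob (if j = i then Out else UNIV - Wrong c))"
      unfolding Box_def using m by (intro measure_PiM_PiE prob_space_axioms)
    also have "\<dots> = q * (\<Prod>j\<in>{..<l} - {i}. prob (UNIV - Wrong c))"
      using that by (subst prod.remove[of _ i]) (auto simp: q_def)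
    also have "(\<Prod>j\<in>{..<l} - {i}. prob (UNIV - Wrong c)) = (1 - prob (Wrong c)) ^ (l - 1)"
      using that prob_compl[OF meas(2)[of c]] by simp
    also have "\<dots> \<le> exp (- (t / real l)) ^ (l - 1)"
    proof (intro power_mono)
      show "1 - prob (Wrong c) \<le> exp (- (t / real l))"
        using that exp_ge_add_one_self[of "- (t / real l)"] unfolding C_def by simp
    qed simp
    \<comment> \<open>Only \<open>l - 1\<close> points are left to avoid \<open>Wrong c\<close>; the
      missing factor costs at most \<open>exp 1 \<le> 3\<close>.\<close>
    also have "\<dots> = exp (t / real l) * exp (- t)"
      using assms by (simp add: exp_of_nat_mult[symmetric] of_nat_diff exp_add[symmetric] field_simps)
    also have "\<dots> \<le> 3 * exp (- t)"
    proof -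
      have "exp (t / real l) \<le> exp 1" using assms by simp
      also have "\<dots> \<le> (3::real)" by (rule exp_le)
      finally show ?thesis by simp
    qed
    finally show "M.prob (Box c i) \<le> q * (3 * exp (- t))"
      using q0 by (simp add: mult_left_mono)
  qed
  have all_out: "PiE {..<l} (\<lambda>_. Out) \<in> sets ?M"
    by (intro measure_PiM_PiE prob_space_axioms) simp
  have boxes: "(\<Union>c\<in>C. \<Union>i<l. Box c i) \<in> sets ?M"
    using box \<open>finite C\<close> by (intro sets.finite_UN) auto
  have "M.prob (PiE {..<l} (\<lambda>_. Out)) \<le> exp (- t) / 2"
  proof -
    have "M.prob (PiE {..<l} (\<lambda>_. Out)) = q ^ l"
      by (subst measure_PiM_PiE) (auto simp: q_def prob_space_axioms)
    \<comment> \<open>The smallness of \<open>q\<close> leaves a factor \<open>1 / 2\<close> to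
      spare for the boxes, and \<open>t < l\<close> gives
      \<open>exp (- l) \<le> exp (- t)\<close>.\<close>
    also have "\<dots> \<le> (exp (- 1) / 2) ^ l"
    proof (intro power_mono q0)
      have "q \<le> 4 * D\<^sup>2 / 1"
        using q assms by (rule_tac order_trans[OF q divide_left_mono]) auto
      also have "\<dots> \<le> 1 / 6" using D2 by simp
      also have "1 / 6 \<le> exp (- 1) / (2::real)"
        using exp_le by (simp add: exp_minus field_simps)
      finally show "q \<le> exp (- 1) / 2" .
    qed
    also have "\<dots> = exp (- real l) * (1 / 2) ^ l"
      by (simp add: power_divide exp_of_nat_mult[symmetric])
    also have "\<dots> \<le> exp (- t) * (1 / 2) ^ 1"
      using assms by (intro mult_mono power_decreasing) auto
    finally show ?thesis by simp
  qed
  moreover have "M.prob (\<Union>c\<in>C. \<Union>i<l. Box c i) \<le> exp (- t) / 2"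
  proof -
    have "M.prob (\<Union>c\<in>C. \<Union>i<l. Box c i) \<le> (\<Sum>c\<in>C. M.prob (\<Union>i<l. Box c i))"
      using box \<open>finite C\<close> by (intro M.finite_measure_subadditive_finite) auto
    also have "\<dots> \<le> (\<Sum>c\<in>C. \<Sum>i<l. M.prob (Box c i))"
      using box by (intro sum_mono M.finite_measure_subadditive_finite) auto
    also have "\<dots> \<le> (\<Sum>c\<in>C. \<Sum>i<l. q * (3 * exp (- t)))"
      by (intro sum_mono box) auto
    also have "\<dots> = real (card C) * (real l * q) * (3 * exp (- t))"
      by simp
    \<comment> \<open>The product is \<open>3 / 8 * exp (- t)\<close>, below the allotted
      half.\<close>
    also have "\<dots> \<le> 2 * (1 / 16) * (3 * exp (- t))"
    proof (intro mult_right_mono mult_mono)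
      show "real l * q \<le> 1 / 16"
      proof -
        have "real l * q \<le> 4 * D\<^sup>2" using q assms(3) by (simp add: pos_le_divide_eq mult.commute)
        then show ?thesis using D2(2) by simp
      qed
    qed (use cardC q0 in auto)
    finally show ?thesis using exp_ge_zero[of "- t"] by linarith
  qed
  moreover have "M.prob X \<le> M.prob (PiE {..<l} (\<lambda>_. Out)) + M.prob (\<Union>c\<in>C. \<Union>i<l. Box c i)"
    unfolding X_def using all_out boxes by (intro measure_Un_le) auto
  ultimately have "M.prob X \<le> exp (- t)" by simp
  moreover have "X \<in> sets ?M" unfolding X_def using all_out boxes by auto
  moreover have "\<forall>w b. max_margin_hyperplane y l x w b \<and> \<Delta> \<le> margin l x w b
       \<longrightarrow> risk P y w b \<le> (D + t) / real l" if x: "x \<in> space ?M - X" for x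
  proof (intro allI impI, elim conjE)
    fix w b assume mm: "max_margin_hyperplane y l x w b" and "\<Delta> \<le> margin l x w b"
    then have w: "w \<noteq> 0" and cl: "classifies y l x w b" by (auto simp: max_margin_hyperplane_def)
    note sm = signed_margin_ge[where y = y, OF w cl \<open>\<Delta> \<le> margin l x w b\<close> _ y_range]
    have ext: "x \<in> extensional {..<l}" using x by (auto simp: space_PiM PiE_def)
    have "x \<notin> PiE {..<l} (\<lambda>_. Out)" using x by (auto simp: X_def)
    then obtain i where i: "i < l" "x i \<notin> Out" using ext by (auto simp: PiE_iff)
    define c where "c = y (x i)"
    have c: "c \<in> {-1, 1}" using y_range by (simp add: c_def)
    have ball: "side w b z = c" if "norm z < \<Delta> / 2" for z
    proof -
      have "norm (z - x i) < \<Delta>"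
        using that i(2) norm_triangle_ineq4[of z "x i"] by (simp add: Out_def)
      then have "norm w * norm (z - x i) < \<Delta> * norm w"
        using w by simp
      then have "\<bar>w \<bullet> (z - x i)\<bar> < \<Delta> * norm w"
        using Cauchy_Schwarz_ineq2[of w "z - x i"] by linarith
      then have "0 < c * (w \<bullet> z + b)"
        using sm[OF i(1)] c unfolding c_def[symmetric] by (auto simp: inner_diff_right)
      then show ?thesis using side_neq_iff[OF c, of w b z] by auto
    qed
    have label: "y (x j) = c" if "j < l" "x j \<notin> Out" for j
      using ball[of "x j"] that cl by (auto simp: Out_def classifies_def)
    \<comment> \<open>A sample point with the other label must lie in \<open>Out\<close>, as inner
      sample points all have label \<open>c\<close>. It is the one point that \<open>Box c j\<close>
      exempts, so \<open>c \<in> C\<close> would put \<open>x\<close> into \<open>X\<close>.\<close>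
    obtain j where j: "j < l" "y (x j) \<noteq> c"
      using max_margin_hyperplane_both_labels[OF mm _ c] assms(3) by auto
    then have "x j \<in> Out" using label by blast
    then have "x \<in> Box c j"
      using ext label by (auto simp: Box_def PiE_iff Wrong_def Out_def not_less[symmetric])
    then have "c \<notin> C" using x j(1) by (auto simp: X_def)
    then have "prob (Wrong c) \<le> t / real l" using c by (auto simp: C_def)
    moreover have "risk P y w b \<le> prob (Out \<union> Wrong c)"
      unfolding risk_def
    proof (rule finite_measure_mono)
      show "{z \<in> space P. side w b z \<noteq> y z} \<subseteq> Out \<union> Wrong c"
        using ball by (auto simp: Out_def Wrong_def)
    qed simp
    moreover have "prob (Out \<union> Wrong c) \<le> q + prob (Wrong c)"
      unfolding q_def by (intro measure_Un_le) auto
    \<comment> \<open>For \<open>D \<le> 1 / 8\<close> the quadratic bound on the outer mass falls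
      below the linear one.\<close>
    moreover have "4 * D\<^sup>2 / real l \<le> D / real l"
    proof (rule divide_right_mono)
      show "4 * D\<^sup>2 \<le> D" using D2(1) \<open>0 \<le> D\<close> by linarith
    qed simp
    ultimately show "risk P y w b \<le> (D + t) / real l"
      using q by (simp add: add_divide_distrib)
  qed
  ultimately show ?thesis
    by (intro with_prob_geI M.prob_space_axioms)
qed

section \<open>Large ratio: discretization and the walk\<close>

text \<open>
  The data are coded by a countable type, which makes all sets of samples measurable: a point
  of the ball by the index of a nearby point of a countable dense set, with its label, and all
  other points by \<open>None\<close>. The offset of the hyperplane becomes the second component of a
  vector in \<open>'a \<times> real\<close>.
\<close>

lemma large_ratio:
  fixes \<Delta> t :: real and l :: nat
  defines "D \<equiv> r * sqrt (real l) / \<Delta>"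
  defines "X \<equiv> 10000 * D * (1 + ln (real l))"
  assumes "0 < \<Delta>" "1 \<le> l" "1 / 8 \<le> D" "0 < t" "X + t < real l"
  shows "with_prob_ge (PiM {..<l} (\<lambda>_. P)) (1 - exp (- t))
    (\<lambda>x. \<forall>w b. max_margin_hyperplane y l x w b \<and> \<Delta> \<le> margin l x w b
       \<longrightarrow> risk P y w b \<le> (X + t) / real l)"
proof -
  let ?M = "PiM {..<l} (\<lambda>_. P)"
  interpret M: prob_space ?M by (rule prob_space_sample)
  \<comment> \<open>With this radius the bound \<open>r\<^sup>2 / R\<^sup>2\<close> on the mass
    outside the ball is exactly \<open>D / l\<close>.\<close>
  define R where "R = \<Delta> * sqrt D"
  have R2: "R\<^sup>2 = \<Delta>\<^sup>2 * D" using assms by (simp add: R_def power_mult_distrib)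
  have "\<Delta> \<le> 3 * R"
  proof -
    have "\<Delta>\<^sup>2 * 1 \<le> \<Delta>\<^sup>2 * (9 * D)" using assms(5) by (intro mult_left_mono) auto
    then have "\<Delta>\<^sup>2 \<le> (3 * R)\<^sup>2" by (simp add: power_mult_distrib R2)
    then show ?thesis by (rule power2_le_imp_le) (use assms in \<open>simp add: R_def\<close>)
  qed
  have "0 < R" using assms by (simp add: R_def)
  \<comment> \<open>The clamped offset is at most \<open>\<rho>\<close> in absolute value; dividing
    it by \<open>\<rho>\<close> in \<open>v\<close>, and putting \<open>\<rho>\<close> into
    \<open>u\<close>, keeps the squared norm of \<open>v\<close> at most \<open>2\<close>.\<close>
  define \<rho> where "\<rho> = R + \<Delta>"
  have "0 < \<rho>" "\<rho> \<le> 4 * R" using \<open>0 < R\<close> \<open>\<Delta> \<le> 3 * R\<close> assms by (auto simp: \<rho>_def)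
  obtain S where S: "countable S" "AE z in P. z \<in> closure S"
    using sep by (auto simp: separably_supported_def)
  have "S \<noteq> {}"
    using S(2) AE_False by auto
  define s where "s = from_nat_into S"
  define near where "near z n \<longleftrightarrow> dist z (s n) < \<Delta> / 8" for z n
  have near: "\<exists>n. near z n" if "z \<in> closure S" for z
  proof -
    have "\<forall>e>0. \<exists>p\<in>S. dist p z < e" using that by (simp add: closure_approachable)
    from this[rule_format, of "\<Delta> / 8"] obtain p where "p \<in> S" "dist p z < \<Delta> / 8"
      using assms(3) by auto
    then show ?thesis
      using S(1) from_nat_into_surj[of S p] by (auto simp: near_def s_def dist_commute)
  qed
  \<comment> \<open>Taking the least index makes the choice of a nearby point measurable.\<close>
  define idx where "idx z = (LEAST n. near z n)" for z
  define Ok where "Ok z \<longleftrightarrow> norm z \<le> R \<and> (\<exists>n. near z n)" for z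
  define d where "d z = (if Ok z then Some (idx z, y z = 1) else None)" for z
  have near_idx: "norm (s (idx z) - z) < \<Delta> / 8" if "Ok z" for z
  proof -
    have "near z (idx z)" using that LeastI_ex[of "near z"] by (auto simp: Ok_def idx_def)
    then show ?thesis by (simp add: near_def dist_norm norm_minus_commute)
  qed
  have [measurable]: "(\<lambda>z. near z n) \<in> measurable P (count_space UNIV)" for n
    unfolding near_def by measurable
  have [measurable]: "idx \<in> measurable P (count_space UNIV)" "(\<lambda>z. Ok z) \<in> measurable P (count_space UNIV)"
    unfolding idx_def Ok_def by measurable
  have d_meas: "d \<in> measurable P (count_space UNIV)"
  proof (subst measurable_count_space_eq_countable)
    have "{z \<in> space P. \<not> Ok z} \<in> sets P" by measurable
    moreover have "{z \<in> space P. Ok z \<and> idx z = n \<and> (y z = 1) = c} \<in> sets P" for n c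
      by measurable
    moreover have "d -` {None} = {z. \<not> Ok z}"
      "d -` {Some (n, c)} = {z. Ok z \<and> idx z = n \<and> (y z = 1) = c}" for n c
      by (auto simp: d_def split: if_splits)
    ultimately have "d -` {a} \<in> sets P" for a
      by (cases a) auto
    then show "d \<in> space P \<rightarrow> UNIV \<and> (\<forall>a\<in>UNIV. d -` {a} \<inter> space P \<in> sets P)" by simp
  qed auto
  define N where "N = distr P (count_space UNIV) d"
  interpret N: discrete_prob N
    unfolding N_def discrete_prob_def discrete_prob_axioms_def using d_meas by (auto intro: prob_space_distr)
  \<comment> \<open>The label is multiplied into the datum, so that one inequality describes the
    errors for both labels.\<close>
  define u :: "(nat \<times> bool) option \<Rightarrow> 'a \<times> real" where
    "u = case_option 0 (\<lambda>(n, c). (if c then 1 else - 1) *\<^sub>R (s n, \<rho>))"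
  define B where "B = {Some (n, c :: bool) | n c. norm (s n) \<le> R + \<Delta> / 8}"
  \<comment> \<open>\<open>(11 / 8)\<^sup>2 + 4\<^sup>2 < 18\<close>, where
    \<open>R + \<Delta> / 8 \<le> 11 / 8 * R\<close> and \<open>\<rho> \<le> 4 * R\<close>.\<close>
  define R' where "R' = sqrt 18 * R"
  have u_le: "norm (u a) \<le> R'" if "a \<in> B" for a
  proof -
    obtain n c where a: "a = Some (n, c)" "norm (s n) \<le> R + \<Delta> / 8" using \<open>a \<in> B\<close> by (auto simp: B_def)
    have "(norm (u a))\<^sup>2 = (norm (s n))\<^sup>2 + \<rho>\<^sup>2"
      by (simp add: a u_def norm_Pair)
    also have "\<dots> \<le> (11 / 8 * R)\<^sup>2 + (4 * R)\<^sup>2"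
      using a(2) \<open>\<Delta> \<le> 3 * R\<close> \<open>\<rho> \<le> 4 * R\<close> \<open>0 < \<rho>\<close> by (intro add_mono power_mono) auto
    also have "\<dots> \<le> R'\<^sup>2"
      by (simp add: R'_def power_mult_distrib power_divide)
    finally show ?thesis
      by (rule power2_le_imp_le) (use \<open>0 < R\<close> in \<open>simp add: R'_def\<close>)
  qed
  \<comment> \<open>\<open>2 * (R' / (\<Delta> / 4))\<^sup>2 = 576 * D\<close>, with
    \<open>2\<close> the bound on the squared norm and \<open>\<Delta> / 4\<close> in the role of
    \<open>g\<close>.\<close>
  define K where "K = nat \<lceil>576 * D\<rceil>"
  have K: "576 * D \<le> real K" "real K \<le> 576 * D + 1" using assms(5) by (auto simp: K_def)
  have "2 * (R' / (\<Delta> / 4))\<^sup>2 \<le> real K"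
    using K assms(3) by (simp add: R'_def power_divide power_mult_distrib R2)
  define e where "e = (X + t - D) / real l"
  note ub = union_bound_le[OF assms(4,5,6) K(2) assms(7)[unfolded X_def], folded X_def, folded e_def]
  let ?Q = "PiM {..<l} (\<lambda>_. N)"
  define Bad where "Bad = {f \<in> space ?Q. \<exists>w. (norm w)\<^sup>2 \<le> 2 \<and>
      (\<forall>i<l. f i \<in> B \<longrightarrow> 3 * (\<Delta> / 4) \<le> w \<bullet> u (f i)) \<and> e < N.prob {a\<in>B. w \<bullet> u a < \<Delta> / 4}}"
  have BadQ: "Bad \<in> sets ?Q" by (auto simp: Bad_def N.sets_PiM_N space_PiM)
  have "measure ?Q Bad \<le> (3 * (real l + 1) / (1 / real l)) ^ K * (1 - (e - 1 / real l)) ^ (l - K)"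
    unfolding Bad_def using ub(2,3) assms(3,4) \<open>0 < R\<close> \<open>2 * (R' / (\<Delta> / 4))\<^sup>2 \<le> real K\<close>
    by (intro N.prob_large_risk_le[where R = R' and g = "\<Delta> / 4"] u_le) (auto simp: R'_def intro: order_trans[of _ e])
  also have "\<dots> = (3 * (real l + 1) * real l) ^ K * (1 - (e - 1 / real l)) ^ (l - K)"
    by (simp add: add.commute)
  also note ub(1)
  finally have "measure ?Q Bad \<le> exp (- t)" .
  define cd where "cd = compose {..<l} d"
  have d_meas': "d \<in> measurable P N" using d_meas by (simp add: N_def)
  \<comment> \<open>Coding the points one by one carries the sample distribution to the product of
    \<open>N\<close>, so \<open>Bad\<close> pulls back to an event of the same probability.\<close>
  have cd: "?Q = distr ?M ?Q cd"
  proof -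
    have "distr P N d = N"
      unfolding N_def by (intro distr_cong) auto
    then show ?thesis
      unfolding cd_def using d_meas'
      by (subst distr_PiM_finite_prob_space') (auto intro: prob_space_axioms N.prob_space_axioms)
  qed
  have cd_meas: "cd \<in> measurable ?M ?Q"
    unfolding cd_def compose_def using d_meas' by measurable
  define X' where "X' = cd -` Bad \<inter> space ?M"
  have "X' \<in> sets ?M" using cd_meas BadQ by (auto simp: X'_def)
  moreover have "M.prob X' \<le> exp (- t)"
    using \<open>measure ?Q Bad \<le> exp (- t)\<close> measure_distr[OF cd_meas BadQ] by (simp add: X'_def cd[symmetric])
  moreover have "\<forall>w b. max_margin_hyperplane y l x w b \<and> \<Delta> \<le> margin l x w b
       \<longrightarrow> risk P y w b \<le> (X + t) / real l" if x: "x \<in> space ?M - X'" for x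
  proof (intro allI impI, elim conjE)
    fix w b assume mm: "max_margin_hyperplane y l x w b" and "\<Delta> \<le> margin l x w b"
    then have w: "w \<noteq> 0" and cl: "classifies y l x w b" by (auto simp: max_margin_hyperplane_def)
    define w1 where "w1 = w /\<^sub>R norm w"
    define \<beta> where "\<beta> = b / norm w"
    have w1: "norm w1 = 1" using w by (simp add: w1_def)
    have h: "w \<bullet> z + b = norm w * (w1 \<bullet> z + \<beta>)" for z
      using w by (simp add: w1_def \<beta>_def field_simps)
    define \<beta>' where "\<beta>' = max (- \<rho>) (min \<rho> \<beta>)"
    define v where "v = (w1, \<beta>' / \<rho>)"
    have h_le: "\<bar>w1 \<bullet> z\<bar> \<le> norm z" for z using Cauchy_Schwarz_ineq2[of w1 z] w1 by simp
    have v: "(norm v)\<^sup>2 \<le> 2"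
    proof -
      have "\<bar>\<beta>' / \<rho>\<bar> \<le> 1" using \<open>0 < \<rho>\<close> by (auto simp: \<beta>'_def field_simps abs_le_iff)
      then have "(\<beta>' / \<rho>)\<^sup>2 \<le> 1" by (simp add: abs_square_le_1)
      then show ?thesis by (simp add: v_def norm_Pair w1 del: abs_divide)
    qed
    have dB: "d z \<in> B" if "Ok z" for z
    proof -
      have "norm (s (idx z)) \<le> norm z + norm (s (idx z) - z)" using norm_triangle_sub by blast
      then show ?thesis using near_idx[OF that] that by (auto simp: B_def d_def Ok_def)
    qed
    \<comment> \<open>Coding shifts the signed value by at most \<open>\<Delta> / 8\<close>: values
      of at least \<open>\<Delta>\<close> stay above \<open>3 * (\<Delta> / 4)\<close>, and those of
      errors stay below \<open>\<Delta> / 4\<close>.\<close>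
    have vu: "\<bar>v \<bullet> u (d z) - y z * (w1 \<bullet> z + \<beta>')\<bar> \<le> \<Delta> / 8" if "Ok z" for z
    proof -
      have "v \<bullet> u (d z) = y z * (w1 \<bullet> s (idx z) + \<beta>')"
        using that y_range[of z] \<open>0 < \<rho>\<close> by (auto simp: v_def u_def d_def)
      then have "v \<bullet> u (d z) - y z * (w1 \<bullet> z + \<beta>') = y z * (w1 \<bullet> (s (idx z) - z))"
        by (simp add: algebra_simps inner_diff_right)
      also have "\<bar>\<dots>\<bar> \<le> norm (s (idx z) - z)"
        using h_le[of "s (idx z) - z"] y_range[of z] by auto
      finally show ?thesis using near_idx[OF that] by simp
    qed
    have clamp: "\<Delta> \<le> y z * (w1 \<bullet> z + \<beta>) \<Longrightarrow> \<Delta> \<le> y z * (w1 \<bullet> z + \<beta>')"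
      "y z * (w1 \<bullet> z + \<beta>) \<le> 0 \<Longrightarrow> y z * (w1 \<bullet> z + \<beta>') \<le> 0" if "Ok z" for z
      using clamp_signed_ge[OF y_range[of z], of "w1 \<bullet> z" R \<Delta> \<beta>] h_le[of z] that assms(3)
      unfolding \<beta>'_def \<rho>_def Ok_def by (blast intro: order_trans)+
    have cdx: "cd x \<in> space ?Q - Bad"
      using x measurable_space[OF cd_meas, of x] by (auto simp: X'_def)
    have "3 * (\<Delta> / 4) \<le> v \<bullet> u (cd x i)" if "i < l" "cd x i \<in> B" for i
    proof -
      have cdi: "cd x i = d (x i)" using that by (simp add: cd_def compose_def)
      then have "Ok (x i)" using that by (auto simp: B_def d_def split: if_splits)
      have "norm w * \<Delta> \<le> norm w * (y (x i) * (w1 \<bullet> x i + \<beta>))"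
        using signed_margin_ge[where y = y, OF w cl \<open>\<Delta> \<le> margin l x w b\<close> that(1) y_range]
        by (simp add: h mult.commute mult.left_commute)
      then have "\<Delta> \<le> y (x i) * (w1 \<bullet> x i + \<beta>)" using w by simp
      from clamp(1)[OF \<open>Ok (x i)\<close> this] vu[OF \<open>Ok (x i)\<close>] show ?thesis
        unfolding cdi using assms(3) by linarith
    qed
    note sample = this
    have le_e: "N.prob {a\<in>B. v \<bullet> u a < \<Delta> / 4} \<le> e"
    proof (rule ccontr)
      assume "\<not> ?thesis"
      then have "cd x \<in> Bad"
        unfolding Bad_def using cdx v sample
        by (intro CollectI conjI exI[of _ v] allI impI) (simp_all only: not_le Diff_iff)
      then show False using cdx by simp
    qed
    define A where "A = {a\<in>B. v \<bullet> u a < \<Delta> / 4}"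
    have dA: "d z \<in> A" if "y z * (w \<bullet> z + b) \<le> 0" "Ok z" for z
    proof -
      have "norm w * (y z * (w1 \<bullet> z + \<beta>)) \<le> 0" using that(1) by (simp add: h mult.left_commute)
      then have "y z * (w1 \<bullet> z + \<beta>) \<le> 0" using w by (simp add: mult_le_0_iff)
      from clamp(2)[OF that(2) this] vu[OF that(2)] assms(3) have "v \<bullet> u (d z) < \<Delta> / 4" by linarith
      then show ?thesis using dB[OF that(2)] by (simp add: A_def)
    qed
    have out: "prob {z. R \<le> norm z} \<le> D / real l"
    proof -
      have "prob {z. R \<le> norm z} \<le> r\<^sup>2 / R\<^sup>2" by (rule prob_norm_ge) fact
      also have "\<dots> = (D\<^sup>2 / real l) / D"
        using assms(3,4,5) by (simp add: R2 D_def power_mult_distrib power_divide)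
      also have "\<dots> = D / real l" using assms(5) by (simp add: power2_eq_square)
      finally show ?thesis .
    qed
    have sA: "d -` A \<in> sets P" using measurable_sets[OF d_meas, of A] by simp
    have sR: "{z. R \<le> norm z} \<in> sets P"
    proof -
      have "{z \<in> space P. R \<le> norm z} \<in> sets P" by measurable
      then show ?thesis by simp
    qed
    \<comment> \<open>An error lies outside the ball, is coded into \<open>A\<close>, or belongs to
      the null set of points not in \<open>closure S\<close>.\<close>
    have "risk P y w b \<le> prob (d -` A \<union> {z. R \<le> norm z})"
      unfolding risk_eq
    proof (rule finite_measure_mono_AE)
      show "AE z in P. z \<in> {z. y z * (w \<bullet> z + b) \<le> 0} \<longrightarrow> z \<in> d -` A \<union> {z. R \<le> norm z}"
        using S(2)
      proof eventually_elim
        case (elim z)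
        show ?case
        proof (cases "R \<le> norm z")
          case False
          then have "Ok z" using near[OF elim] by (simp add: Ok_def)
          then show ?thesis using dA[of z] by simp
        qed simp
      qed
    qed (use sA sR in auto)
    also have "\<dots> \<le> prob (d -` A) + prob {z. R \<le> norm z}"
      using sA sR by (intro measure_Un_le)
    also have "prob (d -` A) = N.prob A"
      unfolding N_def using d_meas by (subst measure_distr) auto
    finally have "risk P y w b \<le> e + D / real l" using out le_e unfolding A_def by simp
    then show "risk P y w b \<le> (X + t) / real l"
      by (simp add: e_def add_divide_distrib[symmetric])
  qed
  ultimately show ?thesis
    by (intro with_prob_geI M.prob_space_axioms)
qed

section \<open>Combination of the cases\<close>

lemma with_prob_ge_risk_le_error_bound:
  assumes "0 < \<Delta>" "0 < \<delta>" "\<delta> < 1" "1 \<le> l"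
  shows "with_prob_ge (PiM {..<l} (\<lambda>_. P)) (1 - \<delta>)
    (\<lambda>x. \<forall>w b. max_margin_hyperplane y l x w b \<and> \<Delta> \<le> margin l x w b
       \<longrightarrow> risk P y w b \<le> error_bound 10000 l r \<Delta> \<delta>)"
proof -
  define D where "D = r * sqrt (real l) / \<Delta>"
  define X where "X = 10000 * D * (1 + ln (real l))"
  define t where "t = ln (1 / \<delta>)"
  have t: "0 < t" "exp (- t) = \<delta>" using assms by (auto simp: t_def ln_div)
  have D: "0 \<le> D" using assms r_nonneg by (simp add: D_def)
  have ln: "0 \<le> ln (real l)" using assms by simp
  define L where "L = 1 + \<bar>ln (real l)\<bar> + \<bar>ln r\<bar> + \<bar>ln \<Delta>\<bar>"
  have "1 \<le> L" by (simp add: L_def)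
  \<comment> \<open>As \<open>L \<ge> 1\<close>, its power dominates the logarithm in
    \<open>X\<close>, so \<open>10000\<close> serves both as factor and as exponent.\<close>
  have "1 + ln (real l) \<le> L powr 1" using \<open>1 \<le> L\<close> by (simp add: L_def)
  also have "\<dots> \<le> L powr 10000" using \<open>1 \<le> L\<close> by (intro powr_mono) auto
  finally have "X + t \<le> D * (10000 * L powr 10000) + t"
    using mult_left_mono[of "1 + ln (real l)" "L powr 10000" "10000 * D"] D by (simp add: X_def mult_ac)
  then have X: "(X + t) / real l \<le> error_bound 10000 l r \<Delta> \<delta>"
    by (simp add: error_bound_def D_def t_def L_def divide_right_mono)
  have "D \<le> X" using mult_mono[of 1 10000 D "D * (1 + ln (real l))"] ln D
    by (simp add: X_def algebra_simps)
  have weaken: "with_prob_ge (PiM {..<l} (\<lambda>_. P)) (1 - \<delta>)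
    (\<lambda>x. \<forall>w b. max_margin_hyperplane y l x w b \<and> \<Delta> \<le> margin l x w b \<longrightarrow> risk P y w b \<le> a')"
    if "with_prob_ge (PiM {..<l} (\<lambda>_. P)) (1 - \<delta>)
      (\<lambda>x. \<forall>w b. max_margin_hyperplane y l x w b \<and> \<Delta> \<le> margin l x w b \<longrightarrow> risk P y w b \<le> a)"
      "a \<le> a'" for a a'
    using that unfolding with_prob_ge_def by (meson order_trans)
  consider "real l \<le> X + t" | "X + t < real l" "D \<le> 1 / 8" | "X + t < real l" "1 / 8 \<le> D"
    by linarith
  then show ?thesis
  proof cases
    case 1
    \<comment> \<open>Here the bound is at least \<open>1\<close> and holds trivially.\<close>
    then have "1 \<le> error_bound 10000 l r \<Delta> \<delta>" using X assms by (simp add: order_trans[rotated])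
    then have "risk P y w b \<le> error_bound 10000 l r \<Delta> \<delta>" for w b
      using risk_le_1 order_trans by blast
    then show ?thesis
      using assms by (intro with_prob_geI[where X = "{}"] prob_space_sample) auto
  next
    case 2
    then have "t < real l" using \<open>D \<le> X\<close> D by linarith
    have "(D + t) / real l \<le> error_bound 10000 l r \<Delta> \<delta>"
      using \<open>D \<le> X\<close> by (intro order_trans[OF _ X] divide_right_mono) auto
    with small_ratio[OF assms(1,4) 2(2)[unfolded D_def] t(1) \<open>t < real l\<close>]
    show ?thesis unfolding t(2) D_def[symmetric] by (rule weaken)
  next
    case 3
    from large_ratio[OF assms(1,4) 3(2)[unfolded D_def] t(1) 3(1)[unfolded X_def D_def]] X
    show ?thesis unfolding t(2) D_def[symmetric] X_def[symmetric]
      by (rule weaken)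
  qed
qed

end

theorem theorem4:
  "\<exists>c::real. 0 < c \<and> c \<le> const_limit \<and>
     (\<forall>(P :: 'a::{real_inner, complete_space} measure) (y :: 'a \<Rightarrow> real)
        (r :: real) (l :: nat) (\<Delta> :: real) (\<delta> :: real).
        0 < \<Delta> \<longrightarrow> 0 < \<delta> \<longrightarrow> \<delta> < 1 \<longrightarrow> 1 \<le> l \<longrightarrow>
        prob_space P \<longrightarrow> sets P = sets borel \<longrightarrow> separably_supported P \<longrightarrow>
        y \<in> borel_measurable P \<longrightarrow> (\<forall>x. y x \<in> {-1, 1}) \<longrightarrow>
        0 \<le> r \<longrightarrow> integrable P (\<lambda>x. (norm x)\<^sup>2) \<longrightarrow> (\<integral>x. (norm x)\<^sup>2 \<partial>P) = r\<^sup>2 \<longrightarrow>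
        with_prob_ge (Pi\<^sub>M {..<l} (\<lambda>_. P)) (1 - \<delta>)
          (\<lambda>x. \<forall>w b. max_margin_hyperplane y l x w b \<and> \<Delta> \<le> margin l x w b
                  \<longrightarrow> risk P y w b \<le> error_bound c l r \<Delta> \<delta>))"
proof (intro exI[of _ 10000] conjI allI impI)
  fix P :: "'a measure" and y :: "'a \<Rightarrow> real" and r :: real and l :: nat and \<Delta> \<delta> :: real
  assume A: "0 < \<Delta>" "0 < \<delta>" "\<delta> < 1" "1 \<le> l"
    and "prob_space P" "sets P = sets borel" "separably_supported P"
      "y \<in> borel_measurable P" "\<forall>x. y x \<in> {-1, 1}"
      "0 \<le> r" "integrable P (\<lambda>x. (norm x)\<^sup>2)" "(\<integral>x. (norm x)\<^sup>2 \<partial>P) = r\<^sup>2"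
  then interpret labelled_distribution P y r
    by (simp add: labelled_distribution_def labelled_distribution_axioms_def)
  show "with_prob_ge (PiM {..<l} (\<lambda>_. P)) (1 - \<delta>)
    (\<lambda>x. \<forall>w b. max_margin_hyperplane y l x w b \<and> \<Delta> \<le> margin l x w b
       \<longrightarrow> risk P y w b \<le> error_bound 10000 l r \<Delta> \<delta>)"
    by (rule with_prob_ge_risk_le_error_bound) fact+
qed (simp_all add: const_limit_def)

end
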